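(* Let $n$ be a nonnegative integer such that $4n+3$ is prime. Then \[ \sum_{j=0}^{n-1} t_6(j) \left( \sigma(n-j)- 4\sigma\!\left(\tfrac{n-j}{2}\right) \right) = \frac{n(n+1)(2n+1)}{6}. \]
   Context: $t_6(m)=\#\{(x_1,\dots,x_6)\in\mathbb{N}_0^6 : m=\sum_{i=1}^6\frac{x_i(x_i+1)}{2}\}$, with $\mathbb{N}_0=\{0,1,2,\dots\}$ (so $t_6(0)=1$). The function $\sigma$ is defined on $\mathbb{Q}$ by $\sigma(0)=1$, $\sigma(q)=0$ if $q\in\mathbb{Q}\setminus\mathbb{N}_0$, and $\sigma(q)=\sum_{d\mid q} d$ for $q\in\mathbb{N}=\{1,2,\dots\}$. *)

theory Defs
  imports Complex_Main "HOL-Library.FuncSet" "HOL-Computational_Algebra.Primes"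
begin

(* Sextuples are the extensional functions on {1..6}; div is exact because x * (x + 1) is even. *)
definition t6_reps :: "nat \<Rightarrow> (nat \<Rightarrow> nat) set" where
  "t6_reps m = {x \<in> {1..6} \<rightarrow>\<^sub>E UNIV. m = (\<Sum>i=1..6. (x i * (x i + 1)) div 2)}"

definition t6 :: "nat \<Rightarrow> nat" where
  "t6 m = card (t6_reps m)"

(* Here the value at 0 is 1, and the value outside the natural numbers is 0.
   On \<nat> the floor merely recovers the natural number that q is. *)
definition sigma_rat :: "rat \<Rightarrow> nat" where
  "sigma_rat q =
     (if q = 0 then 1
      else if q \<in> \<nat> then (\<Sum>d | d dvd nat \<lfloor>q\<rfloor>. d)
      else 0)"

(* So card in t6 is a genuine count. *)
lemma finite_t6_reps: "finite (t6_reps m)"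
proof (rule finite_subset)
  show "t6_reps m \<subseteq> {1..6} \<rightarrow>\<^sub>E {..m}"
  proof
    fix x assume x: "x \<in> t6_reps m"
    have "x i \<le> m" if i: "i \<in> {1..6}" for i
    proof -
      have "x i \<le> (x i * (x i + 1)) div 2"
        by (cases "x i") auto
      also have "\<dots> \<le> (\<Sum>i=1..6. (x i * (x i + 1)) div 2)"
        using i by (intro member_le_sum) auto
      finally show ?thesis
        using x by (simp add: t6_reps_def)
    qed
    with x show "x \<in> {1..6} \<rightarrow>\<^sub>E {..m}"
      by (auto simp: t6_reps_def PiE_iff)
  qed
qed (intro finite_PiE; simp)

lemma sigma_rat_of_nat: "n > 0 \<Longrightarrow> sigma_rat (of_nat n) = (\<Sum>d | d dvd n. d)"
  by (simp add: sigma_rat_def)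

end

theory Submission
  imports Defs "HOL-Computational_Algebra.Formal_Power_Series"
begin

text \<open>
  With \<open>\<psi> = \<Sum>k. q^(k (k + 1) / 2)\<close>, the number \<open>t\<^sub>6 n\<close> is the coefficient of \<open>q^n\<close> in \<open>\<psi>^6\<close>.
  The logarithmic derivative \<open>q \<psi>' / \<psi>\<close> is \<open>\<Sum>m. (\<sigma>(m) - 4 \<sigma>(m / 2)) q^m\<close>, so comparing coefficients
  in \<open>q (\<psi>^6)' = 6 \<psi>^6 (q \<psi>' / \<psi>)\<close> shows that the sum in question is \<open>n t\<^sub>6 n / 6\<close>. Moreover
  \<open>8 t\<^sub>6 n\<close> is the sum of \<open>- \<chi>(d) d^2\<close> over the divisors \<open>d\<close> of \<open>4 n + 3\<close>, where \<open>\<chi>\<close> is the nontrivial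
  character modulo 4; for \<open>4 n + 3\<close> prime this is \<open>(4 n + 3)^2 - 1 = 8 (n + 1) (2 n + 1)\<close>.
  The logarithmic derivative and the differential equation that identifies \<open>8 \<psi>^6\<close> are both
  instances of an elementary identity in the style of Liouville for functions that are odd in each
  variable, summed over the solutions of \<open>x^2 + 2 d e = N\<close>.
\<close>

section \<open>Sums over the solutions of \<open>x^2 + 2 d e = N\<close>\<close>

definition reps :: "int \<Rightarrow> (int \<times> int \<times> int) set" where
  "reps N = {(x, d, e). x\<^sup>2 + 2 * d * e = N \<and> 0 < d \<and> 0 < e}"

lemma finite_reps: "finite (reps N)"
proof (rule finite_subset)
  show "reps N \<subseteq> {-N..N} \<times> {0..N} \<times> {0..N}"
  proof safe
    fix x d e assume "(x, d, e) \<in> reps N"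
    then have N: "x\<^sup>2 + 2 * (d * e) = N" "0 < d" "0 < e"
      by (auto simp: reps_def mult.assoc)
    have "\<bar>x\<bar> \<le> x\<^sup>2"
      using self_le_power[of "\<bar>x\<bar>" 2] by (cases "x = 0") auto
    moreover have "d \<le> d * e" "e \<le> d * e"
      using N by (auto simp: mult_le_cancel_left1 mult_le_cancel_right1)
    ultimately show "x \<in> {-N..N}" "d \<in> {0..N}" "e \<in> {0..N}"
      using N zero_le_power2[of x] unfolding atLeastAtMost_iff by linarith+
  qed
qed auto

lemma reps_odd:
  assumes "odd N" "(x, d, e) \<in> reps N"
  shows "odd x"
proof -
  have "x\<^sup>2 + 2 * (d * e) = N"
    using assms(2) by (simp add: reps_def mult.assoc)
  then have "odd (x\<^sup>2 + 2 * (d * e))"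
    using assms(1) by simp
  then show ?thesis by simp
qed

text \<open>Reindexing along the involution \<open>h\<close> gives
  \<open>sum f S = - sum f S\<close>. Fixed points are harmless, since \<open>f\<close> vanishes
  there.\<close>

lemma sum_involution_eq_0:
  fixes f :: "'a \<Rightarrow> int"
  assumes "\<And>x. x \<in> S \<Longrightarrow> h x \<in> S" "\<And>x. x \<in> S \<Longrightarrow> h (h x) = x"
    and "\<And>x. x \<in> S \<Longrightarrow> f (h x) = - f x"
  shows "sum f S = 0"
proof -
  have "sum f S = (\<Sum>x\<in>S. - f x)"
    by (rule sum.reindex_bij_witness[of _ h h]) (use assms in auto)
  then show ?thesis
    by (simp add: sum_negf)
qed

text \<open>
  The substitution \<open>a = e - x, b = x + d, c = x + d - e\<close> turns \<open>x^2 + 2 d e\<close> into \<open>a^2 + b^2 - c^2\<close>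
  and the conditions \<open>d, e > 0\<close> into \<open>a > - c, b > c\<close>. The part \<open>\<bar>a\<bar> < c\<close> of this cone cancels under
  \<open>a \<mapsto> - a\<close>. The part \<open>U\<close> with \<open>a > \<bar>c\<bar>\<close> and its image under \<open>(b, c) \<mapsto> (- b, - c)\<close> have equal sums
  and together exhaust \<open>a > \<bar>c\<bar>\<close>, except for \<open>b = c\<close>; over that whole region \<open>f\<close> cancels under
  \<open>b \<mapsto> - b\<close>. Only the walls \<open>a = c\<close> and \<open>b = c\<close> remain.
\<close>

lemma sum_reps_odd:
  fixes f :: "int \<Rightarrow> int \<Rightarrow> int \<Rightarrow> int"
  assumes odd_a: "\<And>a b c. f (- a) b c = - f a b c"
    and odd_b: "\<And>a b c. f a (- b) c = - f a b c"
    and odd_c: "\<And>a b c. f a b (- c) = - f a b c"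
  shows "2 * (\<Sum>(x, d, e)\<in>reps N. f (e - x) (x + d) (x + d - e)) =
    2 * (\<Sum>(a, b)\<in>{(a, b). b\<^sup>2 = N \<and> 0 < a \<and> a < b}. f a b a)
      - (\<Sum>(a, c)\<in>{(a, c). a\<^sup>2 = N \<and> \<bar>c\<bar> < a}. f a c c)"
proof -
  define g where "g = (\<lambda>(a, b, c). f a b c)"
  define Q where "Q = {(a, b, c). a\<^sup>2 + b\<^sup>2 - c\<^sup>2 = N}"
  define S where "S = {(a, b, c). (a, b, c) \<in> Q \<and> - c < a \<and> c < b}"
  define S1 where "S1 = {(a, b, c). (a, b, c) \<in> S \<and> a < c}"
  define S2 where "S2 = {(a, b, c). (a, b, c) \<in> S \<and> a = c}"
  define U where "U = {(a, b, c). (a, b, c) \<in> Q \<and> \<bar>c\<bar> < a \<and> c < b}"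
  define U' where "U' = {(a, b, c). (a, b, c) \<in> Q \<and> \<bar>c\<bar> < a \<and> b < c}"
  define V where "V = {(a, b, c). (a, b, c) \<in> Q \<and> \<bar>c\<bar> < a}"
  define V0 where "V0 = {(a, b, c). (a, b, c) \<in> Q \<and> \<bar>c\<bar> < a \<and> b = c}"
  \<comment> \<open>The inverse comes from \<open>d = a + c\<close> and \<open>e = b - c\<close>,
    whence \<open>x = b - d\<close>.\<close>
  have bij: "bij_betw (\<lambda>(x, d, e). (e - x, x + d, x + d - e)) (reps N) S"
    by (rule bij_betw_byWitness[where f' = "\<lambda>(a, b, c). (b - a - c, a + c, b - c)"])
       (auto simp: reps_def S_def Q_def power2_eq_square algebra_simps)
  have fin: "finite S"
    using bij_betw_finite[OF bij] finite_reps by blast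
  have S: "S = S1 \<union> (S2 \<union> U)"
    by (auto simp: S_def S1_def S2_def U_def)
  have "finite S1" "finite S2" "finite U"
    using fin S by auto
  have "sum g S = sum g S1 + (sum g S2 + sum g U)"
    unfolding S using \<open>finite S1\<close> \<open>finite S2\<close> \<open>finite U\<close>
    by (subst sum.union_disjoint; (subst sum.union_disjoint)?)
       (auto simp: S1_def S2_def U_def)
  moreover have "sum g S1 = 0"
    by (rule sum_involution_eq_0[of _ "\<lambda>(a, b, c). (- a, b, c)"])
       (auto simp: S1_def S_def Q_def g_def odd_a)
  moreover have UU': "sum g U = sum g U'" and bijU: "bij_betw (\<lambda>(a, b, c). (a, - b, - c)) U U'"
  proof -
    show "bij_betw (\<lambda>(a, b, c). (a, - b, - c)) U U'"
      by (rule bij_betw_byWitness[where f' = "\<lambda>(a, b, c). (a, - b, - c)"])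
         (auto simp: U_def U'_def Q_def)
    from sum.reindex_bij_betw[OF this, of g] show "sum g U = sum g U'"
      by (simp add: g_def odd_b odd_c case_prod_unfold)
  qed
  moreover have "2 * sum g U = - sum g V0"
  proof -
    have "finite U'"
      using bij_betw_finite[OF bijU] \<open>finite U\<close> by blast
    \<comment> \<open>\<open>V0\<close> lies outside \<open>S\<close>, so its finiteness is a
      separate matter: \<open>b = c\<close> leaves \<open>a^2 = N\<close>, and \<open>c\<close> is
      bounded by \<open>a\<close>.\<close>
    have "V0 \<subseteq> (\<lambda>(a, c). (a, c, c)) ` ({0..N} \<times> {-N..N})"
    proof -
      have "(a, c, c) \<in> (\<lambda>(a, c). (a, c, c)) ` ({0..N} \<times> {-N..N})"
        if "a\<^sup>2 = N" "\<bar>c\<bar> < a" for a c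
      proof -
        have "a \<le> a\<^sup>2"
          using that self_le_power[of a 2] by auto
        then have "(a, c) \<in> {0..N} \<times> {-N..N}" using that by auto
        then show ?thesis by (rule rev_image_eqI) simp
      qed
      then show ?thesis
        by (auto simp: V0_def Q_def)
    qed
    then have "finite V0"
      by (rule finite_subset) auto
    have V: "V = U \<union> (U' \<union> V0)"
      by (auto simp: V_def U_def U'_def V0_def)
    have "sum g V = sum g U + (sum g U' + sum g V0)"
      unfolding V using \<open>finite U\<close> \<open>finite U'\<close> \<open>finite V0\<close>
      by (subst sum.union_disjoint; (subst sum.union_disjoint)?)
         (auto simp: U_def U'_def V0_def)
    moreover have "sum g V = 0"
      by (rule sum_involution_eq_0[of _ "\<lambda>(a, b, c). (a, - b, c)"])
         (auto simp: V_def Q_def g_def odd_b)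
    ultimately show ?thesis
      using UU' by simp
  qed
  moreover have "sum g S2 = (\<Sum>(a, b)\<in>{(a, b). b\<^sup>2 = N \<and> 0 < a \<and> a < b}. f a b a)"
    by (rule sum.reindex_bij_witness[of _ "\<lambda>(a, b). (a, b, a)" "\<lambda>(a, b, c). (a, b)"])
       (auto simp: S2_def S_def Q_def g_def)
  moreover have "sum g V0 = (\<Sum>(a, c)\<in>{(a, c). a\<^sup>2 = N \<and> \<bar>c\<bar> < a}. f a c c)"
    by (rule sum.reindex_bij_witness[of _ "\<lambda>(a, c). (a, c, c)" "\<lambda>(a, b, c). (a, c)"])
       (auto simp: V0_def Q_def g_def)
  moreover have "sum g S = (\<Sum>(x, d, e)\<in>reps N. f (e - x) (x + d) (x + d - e))"
    using sum.reindex_bij_betw[OF bij, of g] by (simp add: g_def case_prod_unfold)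
  ultimately show ?thesis
    by (simp add: algebra_simps)
qed

lemma sum_reps_odd_zero:
  fixes f :: "int \<Rightarrow> int \<Rightarrow> int \<Rightarrow> int"
  assumes "\<And>x d e. f (- x) d e = - f x d e"
  shows "(\<Sum>(x, d, e)\<in>reps N. f x d e) = 0"
  by (rule sum_involution_eq_0[of _ "\<lambda>(x, d, e). (- x, d, e)"])
     (auto simp: reps_def assms)

text \<open>Antisymmetry is assumed on solutions only: in the application it rests on
  \<open>chi4 e = - chi4 d\<close>, a congruence consequence of the equation.\<close>

lemma sum_reps_antisym_zero:
  fixes f :: "int \<Rightarrow> int \<Rightarrow> int \<Rightarrow> int"
  assumes "\<And>x d e. (x, d, e) \<in> reps N \<Longrightarrow> f x e d = - f x d e"
  shows "(\<Sum>(x, d, e)\<in>reps N. f x d e) = 0"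
proof -
  have swap: "(x, e, d) \<in> reps N" if "(x, d, e) \<in> reps N" for x d e
    using that by (auto simp: reps_def mult_ac)
  show ?thesis
    by (rule sum_involution_eq_0[of _ "\<lambda>(x, d, e). (x, e, d)"])
       (auto intro: swap simp: assms)
qed

text \<open>For odd \<open>N\<close> every \<open>x\<close> is odd, hence nonzero, and the halves
  \<open>x > 0\<close> and \<open>x < 0\<close> contribute equally. Writing
  \<open>x = 2 k + 1\<close> leaves \<open>d\<close> free among the divisors of
  \<open>(N - x^2) / 2\<close>, with \<open>e\<close> the complementary divisor.\<close>

lemma sum_reps_even:
  fixes f :: "int \<Rightarrow> int \<Rightarrow> int \<Rightarrow> int" and N :: nat
  assumes "odd N" and even: "\<And>x d e. f (- x) d e = f x d e"
  shows "(\<Sum>(x, d, e)\<in>reps (int N). f x d e) =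
    2 * (\<Sum>k | (2 * k + 1)\<^sup>2 < N. \<Sum>d | d dvd (N - (2 * k + 1)\<^sup>2) div 2.
      f (2 * int k + 1) (int d) (int ((N - (2 * k + 1)\<^sup>2) div 2 div d)))"
proof -
  define g where "g = (\<lambda>(x, d, e). f x d e)"
  define P where "P = {(x, d, e). (x, d, e) \<in> reps (int N) \<and> 0 < x}"
  define P' where "P' = {(x, d, e). (x, d, e) \<in> reps (int N) \<and> x < 0}"
  define r where "r = (\<lambda>k. (N - (2 * k + 1)\<^sup>2) div 2)"
  define K where "K = {k. (2 * k + 1)\<^sup>2 < N}"
  have odd_x: "odd x" if "(x, d, e) \<in> reps (int N)" for x d e
    using that \<open>odd N\<close> reps_odd[of "int N"] by simp
  have r: "(2 * int k + 1)\<^sup>2 + 2 * int (r k) = int N \<and> 0 < r k" if "k \<in> K" for k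
  proof -
    have "even (N - (2 * k + 1)\<^sup>2)"
      using that \<open>odd N\<close> by (simp add: K_def even_diff_nat)
    then have *: "N = (2 * k + 1)\<^sup>2 + 2 * r k"
      using that by (simp add: K_def r_def)
    have "int N = (2 * int k + 1)\<^sup>2 + 2 * int (r k)"
      by (subst *) simp
    moreover have "0 < r k"
      using that * unfolding K_def by auto
    ultimately show ?thesis by simp
  qed
  have reps: "reps (int N) = P \<union> P'"
    using odd_x by (fastforce simp: P_def P'_def neq_iff)
  then have "finite P" "finite P'"
    using finite_reps[of "int N"] by auto
  then have "sum g (reps (int N)) = sum g P + sum g P'"
    unfolding reps by (rule sum.union_disjoint) (auto simp: P_def P'_def)
  moreover have "sum g P' = sum g P"
    by (rule sum.reindex_bij_witness[of _ "\<lambda>(x, d, e). (- x, d, e)" "\<lambda>(x, d, e). (- x, d, e)"])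
       (auto simp: P_def P'_def g_def even reps_def)
  moreover have "sum g P = (\<Sum>(k, d)\<in>(SIGMA k:K. {d. d dvd r k}).
      f (2 * int k + 1) (int d) (int (r k div d)))"
  proof (rule sum.reindex_bij_witness[of _ "\<lambda>(k, d). (2 * int k + 1, int d, int (r k div d))"
        "\<lambda>(x, d, e). (nat (x div 2), nat d)"])
    have r': "x = 2 * int (nat (x div 2)) + 1 \<and> nat (x div 2) \<in> K \<and> int (r (nat (x div 2))) = d * e \<and> 0 < d \<and> 0 < e"
      if "(x, d, e) \<in> P" for x d e
    proof -
      have de: "x\<^sup>2 + 2 * (d * e) = int N" "0 < d" "0 < e" "0 < x"
        using that by (auto simp: P_def reps_def mult.assoc)
      have "odd x" using that odd_x by (auto simp: P_def)
      with de have x: "x = 2 * int (nat (x div 2)) + 1"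
        by (auto elim!: oddE)
      have "int ((2 * nat (x div 2) + 1)\<^sup>2) = x\<^sup>2"
        by (subst (2) x) simp
      moreover have "0 < d * e" using de by simp
      ultimately have "int ((2 * nat (x div 2) + 1)\<^sup>2) < int N"
        using de(1) by linarith
      then have "nat (x div 2) \<in> K"
        unfolding K_def of_nat_less_iff by simp
      moreover have "(2 * int (nat (x div 2)) + 1)\<^sup>2 = x\<^sup>2"
        using x by metis
      with r[OF \<open>nat (x div 2) \<in> K\<close>] de(1) have "int (r (nat (x div 2))) = d * e"
        by linarith
      ultimately show ?thesis using x de by blast
    qed
    show "(\<lambda>(k, d). (2 * int k + 1, int d, int (r k div d))) ((\<lambda>(x, d, e). (nat (x div 2), nat d)) t) = t"
      if "t \<in> P" for t
      using that r' by (cases t) (fastforce simp: zdiv_int)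
    show "(\<lambda>(x, d, e). (nat (x div 2), nat d)) t \<in> (SIGMA k:K. {d. d dvd r k})" if tP: "t \<in> P" for t
    proof -
      obtain x d e where t: "t = (x, d, e)" by (cases t)
      have "int (nat d) dvd int (r (nat (x div 2)))"
        using r'[of x d e] tP t by auto
      then show ?thesis
        using r'[of x d e] tP t by (simp only: int_dvd_int_iff) simp
    qed
    show "(\<lambda>(x, d, e). (nat (x div 2), nat d)) ((\<lambda>(k, d). (2 * int k + 1, int d, int (r k div d))) t) = t"
      if "t \<in> (SIGMA k:K. {d. d dvd r k})" for t
      by (cases t) auto
    show "(\<lambda>(k, d). (2 * int k + 1, int d, int (r k div d))) t \<in> P" if tK: "t \<in> (SIGMA k:K. {d. d dvd r k})" for t
    proof -
      obtain k d where t: "t = (k, d)" by (cases t)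
      have k: "k \<in> K" "d dvd r k" using tK t by auto
      then have "int d * int (r k div d) = int (r k)"
        by (metis dvd_mult_div_cancel of_nat_mult)
      moreover have "0 < d" "0 < r k div d"
        using r[OF k(1)] k(2) by (auto intro!: Nat.gr0I elim: dvdE)
      ultimately show ?thesis
        using r[OF k(1)] t by (simp add: P_def reps_def mult.assoc)
    qed
    show "(case (\<lambda>(x, d, e). (nat (x div 2), nat d)) t of (k, d) \<Rightarrow> f (2 * int k + 1) (int d) (int (r k div d))) = g t"
      if "t \<in> P" for t
    proof -
      obtain x d e where t: "t = (x, d, e)" by (cases t)
      then have *: "x = 2 * int (nat (x div 2)) + 1" "int (r (nat (x div 2))) = d * e" "0 < d" "0 < e"
        using r' that by auto
      then have "int (r (nat (x div 2)) div nat d) = e" "int (nat d) = d"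
        by (auto simp: zdiv_int)
      then show ?thesis
        using *(1) by (simp add: t g_def)
    qed
  qed
  moreover have "\<dots> = (\<Sum>k\<in>K. \<Sum>d | d dvd r k. f (2 * int k + 1) (int d) (int (r k div d)))"
  proof (rule sum.Sigma[symmetric])
    show "finite K"
      by (rule finite_subset[of _ "{..N}"]) (auto simp: K_def power2_eq_square)
    show "\<forall>k\<in>K. finite {d. d dvd r k}"
      using r by (auto intro!: finite_divisors_nat)
  qed
  ultimately show ?thesis
    by (simp add: g_def K_def r_def)
qed

section \<open>The character modulo 4, divisor sums and triangular numbers\<close>

definition chi4 :: "int \<Rightarrow> int" where
  "chi4 a = (if a mod 4 = 1 then 1 else if a mod 4 = 3 then - 1 else 0)"

lemma chi4_minus: "chi4 (- a) = - chi4 a"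
  unfolding chi4_def by presburger

text \<open>Adding 2 swaps the residues 1 and 3 modulo 4 and preserves evenness, so it flips the
  sign of \<open>chi4\<close>.\<close>

lemma chi4_double_add: "chi4 (2 * j + a) = (if even j then chi4 a else - chi4 a)"
proof (cases "even j")
  case True
  then obtain i where "2 * j + a = a + 4 * i" by (auto elim: evenE)
  then show ?thesis using True by (simp add: chi4_def)
next
  case False
  then obtain i where "2 * j + a = (a + 2) + 4 * i" by (auto elim: oddE)
  then have "chi4 (2 * j + a) = chi4 (a + 2)" by (simp only: chi4_def mod_mult_self2)
  also have "\<dots> = - chi4 a" unfolding chi4_def by presburger
  finally show ?thesis using False by simp
qed

lemma chi4_eq_0: "even a \<Longrightarrow> chi4 a = 0"
  unfolding chi4_def by presburger

lemma chi4_square: "odd a \<Longrightarrow> chi4 a * chi4 a = 1"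
  unfolding chi4_def by presburger

lemma odd_square_mod_8:
  fixes a :: int
  assumes "odd a"
  shows "a\<^sup>2 mod 8 = 1"
proof -
  obtain m where a: "a = 2 * m + 1" using assms by (elim oddE)
  have "even (m * (m + 1))" by simp
  then obtain j where "m * (m + 1) = 2 * j" by (elim evenE)
  then have "a\<^sup>2 = 8 * j + 1"
    by (simp add: a power2_eq_square algebra_simps)
  then show ?thesis by simp
qed

definition divisor_sum_chi4 :: "nat \<Rightarrow> int" where
  "divisor_sum_chi4 m = (\<Sum>d | d dvd m. - chi4 (int d) * (int d)\<^sup>2)"

text \<open>For \<open>m > 0\<close> this is sigma(m) - 4 sigma(m/2), in the signed form that the
  sums over \<open>reps\<close> produce.\<close>

definition altsigma :: "nat \<Rightarrow> int" where
  "altsigma m = (\<Sum>d | d dvd m. (- 1) ^ (d + 1) * int d)"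

definition tri :: "nat \<Rightarrow> nat" where
  "tri k = k * (k + 1) div 2"

text \<open>Through this, subtracting an odd square from \<open>8 n + 7\<close> or
  \<open>8 n + 1\<close> amounts to subtracting a triangular number from \<open>n\<close>.\<close>

lemma square_tri: "(2 * k + 1)\<^sup>2 = 8 * tri k + 1"
proof -
  have "even (k * (k + 1))" by simp
  then have "2 * tri k = k * (k + 1)"
    unfolding tri_def by (rule dvd_mult_div_cancel)
  then show ?thesis
    by (simp add: power2_eq_square algebra_simps)
qed

lemma square_tri_int: "(2 * int k + 1)\<^sup>2 = 8 * int (tri k) + 1"
  using arg_cong[OF square_tri[of k], of int] by (simp add: add.commute)

section \<open>The case \<open>N = 8 n + 7\<close>: a recurrence for
  \<open>divisor_sum_chi4\<close>\<close>

text \<open>An odd square is 1 modulo 8, so \<open>2 d e\<close> is 6 modulo 8 and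
  \<open>d e\<close> is 3 modulo 4: one of \<open>d\<close>, \<open>e\<close> is 1 and the other 3
  modulo 4.\<close>

lemma reps_7_parity:
  assumes "N mod 8 = 7" "(x, d, e) \<in> reps N"
  shows "odd x" "odd d" "odd e" "chi4 e = - chi4 d"
proof -
  have N: "x\<^sup>2 + 2 * (d * e) = N"
    using assms by (simp add: reps_def mult.assoc)
  have "odd N" using assms(1) by presburger
  then show "odd x" using reps_odd assms(2) by blast
  then have "x\<^sup>2 mod 8 = 1" by (rule odd_square_mod_8)
  moreover have "z mod 4 = 3 \<and> odd z" if "y mod 8 = 1" "y + 2 * z = N" for y z
    using that assms(1) by presburger
  ultimately have de: "(d * e) mod 4 = 3" and "odd (d * e)"
    using N by blast+
  then show "odd d" "odd e" by auto
  then have "d mod 4 = 1 \<or> d mod 4 = 3" "e mod 4 = 1 \<or> e mod 4 = 3"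
    by presburger+
  then show "chi4 e = - chi4 d"
    using de unfolding mod_mult_eq[of d 4 e, symmetric] by (auto simp: chi4_def)
qed

text \<open>
  Up to terms that are odd in \<open>x\<close> or antisymmetric in \<open>d\<close> and \<open>e\<close>, the summand is
  \<open>\<chi>(d) (e - x) (x + d)^3\<close>. On the solutions this is \<open>s(a) \<chi>(c) a b^3\<close> in the coordinates of
  \<open>sum_reps_odd\<close>, which is odd in each variable; there are no wall terms since \<open>N\<close> is not a square.
\<close>

lemma sum_reps_7:
  assumes N: "N mod 8 = 7"
  shows "(\<Sum>(x, d, e)\<in>reps N. chi4 d * (d * e - 3 * x\<^sup>2) * d\<^sup>2) = 0"
proof -
  \<comment> \<open>On even \<open>a\<close> this is the sign \<open>(-1)^(a/2)\<close>. It is an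
    even function, so \<open>s a * a\<close> is odd in \<open>a\<close>.\<close>
  define s :: "int \<Rightarrow> int" where "s a = (if 4 dvd a then 1 else if even a then - 1 else 0)" for a
  have not_square: "a\<^sup>2 \<noteq> N" for a
  proof
    assume a: "a\<^sup>2 = N"
    then have "odd (a\<^sup>2)" using N by presburger
    then have "odd a" by simp
    with odd_square_mod_8 a N show False by auto
  qed
  \<comment> \<open>Since \<open>d = a + c\<close> with \<open>a = e - x\<close> even, passing from
    \<open>chi4 c\<close> to \<open>chi4 d\<close> costs exactly the sign
    \<open>s a\<close>.\<close>
  have s_chi4: "s (e - x) * chi4 (x + d - e) = chi4 d" if "(x, d, e) \<in> reps N" for x d e
  proof -
    have "even (e - x)"
      using reps_7_parity[OF N that] by simp
    then obtain j where j: "e - x = 2 * j" by (elim evenE)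
    have "s (e - x) = (if even j then 1 else - 1)"
      unfolding s_def j by (auto elim: evenE)
    moreover have "chi4 d = chi4 (2 * j + (x + d - e))"
      by (simp flip: j)
    ultimately show ?thesis
      unfolding chi4_double_add by simp
  qed
  have "2 * (\<Sum>(x, d, e)\<in>reps N. s (e - x) * chi4 (x + d - e) * ((e - x) * (x + d) ^ 3)) = 0"
    using sum_reps_odd[of "\<lambda>a b c. s a * chi4 c * (a * b ^ 3)" N]
    by (simp add: not_square chi4_minus s_def)
  also have "(\<Sum>(x, d, e)\<in>reps N. s (e - x) * chi4 (x + d - e) * ((e - x) * (x + d) ^ 3)) =
      (\<Sum>(x, d, e)\<in>reps N. chi4 d * (d * e - 3 * x\<^sup>2) * d\<^sup>2
        + chi4 d * (3 * x\<^sup>2 * d * e - x ^ 4)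
        + x * (chi4 d * (e * x\<^sup>2 + 3 * d\<^sup>2 * e - 3 * x\<^sup>2 * d - d ^ 3)))"
    by (rule sum.cong[OF refl])
       (auto simp: s_chi4 power2_eq_square power3_eq_cube power4_eq_xxxx algebra_simps)
  also have "\<dots> = (\<Sum>(x, d, e)\<in>reps N. chi4 d * (d * e - 3 * x\<^sup>2) * d\<^sup>2)
      + (\<Sum>(x, d, e)\<in>reps N. chi4 d * (3 * x\<^sup>2 * d * e - x ^ 4))
      + (\<Sum>(x, d, e)\<in>reps N. x * (chi4 d * (e * x\<^sup>2 + 3 * d\<^sup>2 * e - 3 * x\<^sup>2 * d - d ^ 3)))"
    by (simp add: case_prod_unfold sum.distrib)
  also have "(\<Sum>(x, d, e)\<in>reps N. chi4 d * (3 * x\<^sup>2 * d * e - x ^ 4)) = 0"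
    by (rule sum_reps_antisym_zero) (simp add: reps_7_parity(4)[OF N] algebra_simps)
  also have "(\<Sum>(x, d, e)\<in>reps N. x * (chi4 d * (e * x\<^sup>2 + 3 * d\<^sup>2 * e - 3 * x\<^sup>2 * d - d ^ 3))) = 0"
    by (rule sum_reps_odd_zero) simp
  finally show ?thesis by simp
qed

text \<open>This is \<open>sum_reps_7\<close> at \<open>8 n + 7\<close>. With
  \<open>x = 2 k + 1\<close> one has \<open>d e = 4 (n - tri k) + 3\<close> and
  \<open>3 x^2 = 24 tri k + 3\<close>, so \<open>d e - 3 x^2\<close> is 4 times the stated
  weight.\<close>

lemma divisor_sum_chi4_recurrence:
  "(\<Sum>k | tri k \<le> n. (int (n - tri k) - 6 * int (tri k)) * divisor_sum_chi4 (4 * (n - tri k) + 3)) = 0"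
proof -
  have K: "{k. (2 * k + 1)\<^sup>2 < 8 * n + 7} = {k. tri k \<le> n}"
    unfolding square_tri by auto
  have r: "(8 * n + 7 - (2 * k + 1)\<^sup>2) div 2 = 4 * (n - tri k) + 3" if "tri k \<le> n" for k
    using that unfolding square_tri by simp
  have "0 = (\<Sum>(x, d, e)\<in>reps (int (8 * n + 7)). chi4 d * (d * e - 3 * x\<^sup>2) * d\<^sup>2)"
    by (rule sum_reps_7[symmetric]) presburger
  also have "\<dots> = 2 * (\<Sum>k | tri k \<le> n. \<Sum>d | d dvd (8 * n + 7 - (2 * k + 1)\<^sup>2) div 2.
      chi4 (int d) * (int d * int ((8 * n + 7 - (2 * k + 1)\<^sup>2) div 2 div d) - 3 * (2 * int k + 1)\<^sup>2) * (int d)\<^sup>2)"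
    unfolding K[symmetric] by (subst sum_reps_even) simp_all
  also have "(\<Sum>k | tri k \<le> n. \<Sum>d | d dvd (8 * n + 7 - (2 * k + 1)\<^sup>2) div 2.
      chi4 (int d) * (int d * int ((8 * n + 7 - (2 * k + 1)\<^sup>2) div 2 div d) - 3 * (2 * int k + 1)\<^sup>2) * (int d)\<^sup>2)
    = (\<Sum>k | tri k \<le> n. \<Sum>d | d dvd 4 * (n - tri k) + 3.
      (- 4) * (int (n - tri k) - 6 * int (tri k)) * (- chi4 (int d) * (int d)\<^sup>2))"
  proof (intro sum.cong refl)
    fix k assume "k \<in> {k. tri k \<le> n}"
    then show "{d. d dvd (8 * n + 7 - (2 * k + 1)\<^sup>2) div 2} = {d. d dvd 4 * (n - tri k) + 3}"
      using r by simp
  next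
    fix k d assume k: "k \<in> {k. tri k \<le> n}" and d: "d \<in> {d. d dvd 4 * (n - tri k) + 3}"
    have "int d * int ((8 * n + 7 - (2 * k + 1)\<^sup>2) div 2 div d) = int (4 * (n - tri k) + 3)"
      using k d by (simp only: r mem_Collect_eq of_nat_mult[symmetric] dvd_mult_div_cancel)
    also have "\<dots> = 4 * int (n - tri k) + 3"
      by simp
    finally show "chi4 (int d) * (int d * int ((8 * n + 7 - (2 * k + 1)\<^sup>2) div 2 div d) - 3 * (2 * int k + 1)\<^sup>2) * (int d)\<^sup>2
      = (- 4) * (int (n - tri k) - 6 * int (tri k)) * (- chi4 (int d) * (int d)\<^sup>2)"
      unfolding square_tri_int by (simp add: algebra_simps)
  qed
  also have "\<dots> = (- 4) * (\<Sum>k | tri k \<le> n. (int (n - tri k) - 6 * int (tri k)) * divisor_sum_chi4 (4 * (n - tri k) + 3))"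
    by (simp only: divisor_sum_chi4_def sum_distrib_left mult.assoc)
  finally show ?thesis by simp
qed

section \<open>The case \<open>N = 8 n + 1\<close>: a recurrence for \<open>altsigma\<close>\<close>

lemma sum_chi4_square: "(\<Sum>a\<in>{0<..<2 * int k + 1}. chi4 a * chi4 a) = int k"
proof (induction k)
  case (Suc k)
  have "{0<..<2 * int (Suc k) + 1} = insert (2 * int k + 1) (insert (2 * int k + 2) {0<..<2 * int k + 1})"
    by auto
  with Suc show ?case
    by (simp add: chi4_square chi4_eq_0)
next
  case 0
  have "{0<..<1} = ({} :: int set)" by auto
  then show ?case by simp
qed

text \<open>In the induction step the new terms at \<open>2 k + 1\<close> and its negative are
  equal, the even ones vanish, and \<open>chi4\<close> changes sign from \<open>2 k + 1\<close> to
  \<open>2 k + 3\<close>.\<close>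

lemma sum_chi4_linear: "(\<Sum>c | \<bar>c\<bar> < 2 * int k + 1. chi4 c * c) = - 2 * int k * chi4 (2 * int k + 1)"
proof (induction k)
  case 0
  have "{c. \<bar>c\<bar> < 1} = {0::int}" by auto
  then show ?case by simp
next
  case (Suc k)
  let ?S = "{c. \<bar>c\<bar> < 2 * int k + 1}"
  have "finite ?S"
    by (rule finite_subset[of _ "{- (2 * int k + 1)..2 * int k + 1}"]) auto
  moreover have "{c. \<bar>c\<bar> < 2 * int (Suc k) + 1} = insert (2 * int k + 1) (insert (- (2 * int k + 1))
      (insert (2 * int k + 2) (insert (- (2 * int k + 2)) ?S)))"
    by auto
  moreover have "chi4 (2 * int (Suc k) + 1) = - chi4 (2 * int k + 1)"
    using chi4_double_add[of 1 "2 * int k + 1"] by (simp add: algebra_simps)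
  moreover have "chi4 (- (2 * int k + 1)) = - chi4 (2 * int k + 1)"
    "chi4 (2 * int k + 2) = 0" "chi4 (- (2 * int k + 2)) = 0"
    by (simp_all add: chi4_eq_0 chi4_minus del: minus_add_distrib)
  ultimately show ?case
    using Suc by (simp add: algebra_simps)
qed

text \<open>Here \<open>sum_reps_odd\<close> is applied to \<open>chi4 a * chi4 c * b\<close>. The
  walls are empty unless \<open>8 n + 1\<close> is a square \<open>m^2\<close> with
  \<open>m = 2 k + 1\<close>; then they contribute
  \<open>2 k m + 2 k = m^2 - 1 = 8 n\<close>.\<close>

lemma sum_reps_1:
  "2 * (\<Sum>(x, d, e)\<in>reps (int (8 * n + 1)). chi4 (e - x) * chi4 (x + d - e) * (x + d)) =
     (if n \<in> range tri then 8 * int n else 0)"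
proof -
  let ?N = "int (8 * n + 1)"
  have "2 * (\<Sum>(x, d, e)\<in>reps ?N. chi4 (e - x) * chi4 (x + d - e) * (x + d)) =
    2 * (\<Sum>(a, b)\<in>{(a, b). b\<^sup>2 = ?N \<and> 0 < a \<and> a < b}. chi4 a * chi4 a * b)
      - (\<Sum>(a, c)\<in>{(a, c). a\<^sup>2 = ?N \<and> \<bar>c\<bar> < a}. chi4 a * chi4 c * c)"
    by (rule sum_reps_odd) (simp_all add: chi4_minus)
  also have "\<dots> = (if n \<in> range tri then 8 * int n else 0)"
  proof (cases "n \<in> range tri")
    case True
    then obtain k where k: "n = tri k" by auto
    define m where "m = 2 * int k + 1"
    have m: "m\<^sup>2 = ?N"
      using square_tri_int[of k] by (simp add: m_def k)
    have root: "a\<^sup>2 = ?N \<longleftrightarrow> a = m \<or> a = - m" for a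
      unfolding m[symmetric] by (rule power2_eq_iff)
    have "0 < m" by (simp add: m_def)
    then have "{(a, b). b\<^sup>2 = ?N \<and> 0 < a \<and> a < b} = {0<..<m} \<times> {m}"
      "{(a, c). a\<^sup>2 = ?N \<and> \<bar>c\<bar> < a} = {m} \<times> {c. \<bar>c\<bar> < m}"
      unfolding root by auto
    then have "2 * (\<Sum>(a, b)\<in>{(a, b). b\<^sup>2 = ?N \<and> 0 < a \<and> a < b}. chi4 a * chi4 a * b)
      - (\<Sum>(a, c)\<in>{(a, c). a\<^sup>2 = ?N \<and> \<bar>c\<bar> < a}. chi4 a * chi4 c * c)
      = 2 * ((\<Sum>a\<in>{0<..<m}. chi4 a * chi4 a) * m) - chi4 m * (\<Sum>c | \<bar>c\<bar> < m. chi4 c * c)"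
      by (simp add: sum.cartesian_product[symmetric] sum_distrib_left sum_distrib_right mult.assoc)
    also have "\<dots> = 2 * (int k * m) + 2 * int k * (chi4 m * chi4 m)"
      unfolding m_def sum_chi4_square sum_chi4_linear by (simp add: algebra_simps)
    also have "chi4 m * chi4 m = 1"
      by (rule chi4_square) (simp add: m_def)
    also have "2 * (int k * m) + 2 * int k * 1 = m\<^sup>2 - 1"
      by (simp add: m_def power2_eq_square algebra_simps)
    finally show ?thesis
      using True m by simp
  next
    case False
    have "a\<^sup>2 \<noteq> ?N" for a
    proof
      assume a: "a\<^sup>2 = ?N"
      then have "odd (a\<^sup>2)" by simp
      then have "odd (nat \<bar>a\<bar>)" by (simp add: even_nat_iff)
      then obtain k where k: "nat \<bar>a\<bar> = 2 * k + 1" by (elim oddE)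
      have "int ((nat \<bar>a\<bar>)\<^sup>2) = ?N"
        using a by simp
      then have "8 * n + 1 = 8 * tri k + 1"
        unfolding k square_tri by linarith
      with False show False by auto
    qed
    with False show ?thesis by simp
  qed
  finally show ?thesis .
qed

lemma altsigma_recurrence:
  "(\<Sum>k | tri k < n. altsigma (n - tri k)) = (if n \<in> range tri then int n else 0)"
proof -
  let ?R = "reps (int (8 * n + 1))"
  \<comment> \<open>As \<open>c = d - a\<close>, the product \<open>chi4 a * chi4 c\<close> depends
    on \<open>d\<close> and \<open>e\<close> alone: \<open>a\<close> and \<open>c\<close> are both
    odd only for even \<open>d\<close> and \<open>e\<close>, and then \<open>d / 2\<close> decides
    the sign. Hence the part \<open>x * w d e\<close> of the summand is odd in
    \<open>x\<close>.\<close>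
  define w where "w d e = (if even d \<and> even e then (- 1) ^ (nat d div 2 + 1) else 0 :: int)" for d e :: int
  have w: "chi4 (e - x) * chi4 (x + d - e) = w d e" if "(x, d, e) \<in> ?R" for x d e
  proof -
    have N: "x\<^sup>2 + 2 * (d * e) = 8 * int n + 1" "0 < d"
      using that by (auto simp: reps_def mult.assoc)
    have "odd x"
      using reps_odd[OF _ that] by simp
    then have "x\<^sup>2 mod 8 = 1" by (rule odd_square_mod_8)
    moreover have "even z" if "y mod 8 = 1" "y + 2 * z = 8 * int n + 1" for y z
      using that by presburger
    ultimately have "even (d * e)" using N(1) by blast
    then have "even d \<or> even e" by simp
    consider "even d" "even e" | "odd d" | "odd e" by blast
    then show ?thesis
    proof cases
      case 1
      then obtain j where j: "d = 2 * j" by (elim evenE)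
      then have "nat d div 2 = nat j" "0 < j" using N(2) by auto
      moreover have "(- 1) ^ (nat j + 1) = (if even j then - 1 else 1 :: int)"
        using \<open>0 < j\<close> by (simp add: even_nat_iff)
      moreover have "chi4 (e - x) * chi4 (x + d - e) = (if even j then - 1 else 1)"
      proof -
        have "odd (e - x)" using \<open>even e\<close> \<open>odd x\<close> by simp
        moreover have "x + d - e = 2 * j + - (e - x)" using j by simp
        ultimately show ?thesis
          by (simp only: chi4_double_add chi4_minus) (simp add: chi4_square)
      qed
      ultimately show ?thesis using 1 by (simp add: w_def)
    next
      case 2
      then have "even e" using \<open>even d \<or> even e\<close> by simp
      then have "chi4 (x + d - e) = 0"
        using 2 \<open>odd x\<close> by (intro chi4_eq_0) simp
      then show ?thesis using 2 by (simp add: w_def)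
    next
      case 3
      then have "chi4 (e - x) = 0"
        using \<open>odd x\<close> by (intro chi4_eq_0) simp
      then show ?thesis using 3 by (simp add: w_def)
    qed
  qed
  have K: "{k. (2 * k + 1)\<^sup>2 < 8 * n + 1} = {k. tri k < n}"
    unfolding square_tri by auto
  have r: "(8 * n + 1 - (2 * k + 1)\<^sup>2) div 2 = 4 * (n - tri k)" for k
    unfolding square_tri by simp
  \<comment> \<open>The divisors \<open>d\<close> of \<open>4 m\<close> with \<open>d\<close> and
    \<open>4 m / d\<close> both even are the doubles of the divisors of \<open>m\<close>.\<close>
  have inner: "(\<Sum>d | d dvd 4 * m. w (int d) (int (4 * m div d)) * int d) = 2 * altsigma m" if "0 < m" for m
  proof -
    have "(\<Sum>d | d dvd 4 * m. w (int d) (int (4 * m div d)) * int d)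
        = (\<Sum>d\<in>(*) 2 ` {d. d dvd m}. w (int d) (int (4 * m div d)) * int d)"
    proof (rule sum.mono_neutral_right)
      show "finite {d. d dvd 4 * m}"
        using that by (intro finite_divisors_nat) simp
      show "(*) 2 ` {d. d dvd m} \<subseteq> {d. d dvd 4 * m}"
      proof safe
        fix d assume "d dvd m"
        then have "2 * d dvd 2 * 2 * m" by (simp only: mult.assoc) (auto intro: dvd_mult)
        then show "2 * d dvd 4 * m" by simp
      qed
      show "\<forall>d\<in>{d. d dvd 4 * m} - (*) 2 ` {d. d dvd m}. w (int d) (int (4 * m div d)) * int d = 0"
      proof
        fix d assume d: "d \<in> {d. d dvd 4 * m} - (*) 2 ` {d. d dvd m}"
        show "w (int d) (int (4 * m div d)) * int d = 0"
        proof (rule ccontr)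
          assume "w (int d) (int (4 * m div d)) * int d \<noteq> 0"
          then have "even d" "even (4 * m div d)"
            by (auto simp: w_def split: if_splits)
          then obtain d' e' where d': "d = 2 * d'" "4 * m div d = 2 * e'"
            by (elim evenE)
          have "d * (4 * m div d) = 4 * m"
            using d by simp
          then have "m = d' * e'"
            unfolding d'(2) by (simp add: d'(1))
          with d d'(1) show False by auto
        qed
      qed
    qed
    also have "\<dots> = (\<Sum>d | d dvd m. w (int (2 * d)) (int (4 * m div (2 * d))) * int (2 * d))"
      by (subst sum.reindex) (simp_all add: inj_on_def)
    also have "\<dots> = (\<Sum>d | d dvd m. 2 * ((- 1) ^ (d + 1) * int d))"
    proof (rule sum.cong[OF refl])
      fix d assume "d \<in> {d. d dvd m}"
      then obtain e where e: "m = d * e" by (auto elim: dvdE)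
      then have "4 * m div (2 * d) = 2 * e"
        using \<open>0 < m\<close> by simp
      then show "w (int (2 * d)) (int (4 * m div (2 * d))) * int (2 * d) = 2 * ((- 1) ^ (d + 1) * int d)"
        by (simp add: w_def nat_mult_distrib)
    qed
    finally show ?thesis
      by (simp add: altsigma_def sum_distrib_left)
  qed
  have "(\<Sum>(x, d, e)\<in>?R. chi4 (e - x) * chi4 (x + d - e) * (x + d)) = (\<Sum>(x, d, e)\<in>?R. x * w d e + w d e * d)"
    by (rule sum.cong[OF refl]) (auto simp: w algebra_simps)
  also have "\<dots> = (\<Sum>(x, d, e)\<in>?R. x * w d e) + (\<Sum>(x, d, e)\<in>?R. w d e * d)"
    by (simp add: case_prod_unfold sum.distrib)
  also have "(\<Sum>(x, d, e)\<in>?R. x * w d e) = 0"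
    by (rule sum_reps_odd_zero) simp
  also have "(\<Sum>(x, d, e)\<in>?R. w d e * d) = 2 * (\<Sum>k | tri k < n. \<Sum>d | d dvd 4 * (n - tri k).
      w (int d) (int (4 * (n - tri k) div d)) * int d)"
    by (subst sum_reps_even) (simp_all only: K r, simp)
  also have "\<dots> = 4 * (\<Sum>k | tri k < n. altsigma (n - tri k))"
    by (simp add: inner sum_distrib_left)
  finally show ?thesis
    using sum_reps_1[of n] by (simp split: if_splits)
qed

section \<open>The generating series \<open>psi\<close> and its differential equations\<close>

lemma strict_mono_tri: "strict_mono tri"
proof (rule strict_monoI)
  fix i j :: nat assume "i < j"
  then have "(2 * i + 1)\<^sup>2 < (2 * j + 1)\<^sup>2"
    by (intro power_strict_mono) auto
  then show "tri i < tri j"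
    unfolding square_tri by simp
qed

unbundle fps_syntax

definition psi :: "rat fps" where
  "psi = Abs_fps (\<lambda>n. if n \<in> range tri then 1 else 0)"

lemma sum_psi: "(\<Sum>i=0..n. psi $ i * h i) = (\<Sum>k | tri k \<le> n. h (tri k))"
proof -
  have "(\<Sum>i=0..n. psi $ i * h i) = (\<Sum>i\<in>tri ` {k. tri k \<le> n}. h i)"
    by (rule sum.mono_neutral_cong_right) (auto simp: psi_def)
  also have "\<dots> = (\<Sum>k | tri k \<le> n. h (tri k))"
    using strict_mono_on_imp_inj_on[OF strict_mono_tri]
    by (subst sum.reindex) (auto simp: inj_on_def)
  finally show ?thesis .
qed

text \<open>The Euler operator \<open>q d/dq\<close>; applied to a product with \<open>psi\<close>
  it yields the weights \<open>tri k\<close> and \<open>n - tri k\<close> of the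
  recurrences.\<close>

lemma fps_X_deriv_nth: "(fps_X * fps_deriv f) $ n = of_nat n * (f $ n :: 'a :: comm_ring_1)"
  by (cases n) simp_all

lemma fps_numeral_mult_nth: "(numeral k * f) $ n = numeral k * (f $ n :: 'a :: comm_ring_1)"
  by (simp add: numeral_fps_const fps_mult_left_const_nth)

lemma X_deriv_psi: "fps_X * fps_deriv psi = psi * Abs_fps (\<lambda>m. of_int (altsigma m))"
proof (rule fps_ext)
  fix n
  \<comment> \<open>a junk value: 0 has infinitely many divisors\<close>
  have 0: "altsigma 0 = 0"
    by (simp add: altsigma_def)
  have fin: "finite {k. tri k \<le> n}"
    by (rule finite_subset[of _ "{..n}"]) (use strict_mono_imp_increasing[OF strict_mono_tri] in \<open>auto intro: order_trans\<close>)
  have "(psi * Abs_fps (\<lambda>m. of_int (altsigma m))) $ n = (\<Sum>k | tri k \<le> n. of_int (altsigma (n - tri k)))"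
    unfolding fps_mult_nth sum_psi by simp
  also have "\<dots> = (\<Sum>k | tri k < n. of_int (altsigma (n - tri k)))"
    by (rule sum.mono_neutral_right[OF fin]) (auto simp: 0)
  also have "\<dots> = of_int (\<Sum>k | tri k < n. altsigma (n - tri k))"
    by simp
  also have "\<dots> = (fps_X * fps_deriv psi) $ n"
    unfolding altsigma_recurrence fps_X_deriv_nth by (simp add: psi_def)
  finally show "(fps_X * fps_deriv psi) $ n = (psi * Abs_fps (\<lambda>m. of_int (altsigma m))) $ n" ..
qed

text \<open>Both sides, as series \<open>F\<close> in \<open>q\<close>, satisfy
  \<open>psi * q F' = 6 q psi' * F\<close>. As \<open>psi $ 0 = 1\<close>, this linear equation
  determines \<open>F\<close> from its constant term, which is 8 for both.\<close>

lemma divisor_sum_chi4_eq_psi: "of_int (divisor_sum_chi4 (4 * n + 3)) = 8 * psi ^ 6 $ n"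
proof -
  define A where "A = Abs_fps (\<lambda>n. of_int (divisor_sum_chi4 (4 * n + 3)) :: rat)"
  define B where "B = A - 8 * psi ^ 6"
  have A: "psi * (fps_X * fps_deriv A) = 6 * (fps_X * fps_deriv psi) * A"
  proof (rule fps_ext)
    fix n
    have 1: "(psi * (fps_X * fps_deriv A)) $ n = (\<Sum>k | tri k \<le> n. of_nat (n - tri k) * A $ (n - tri k))"
      unfolding fps_mult_nth[of psi] sum_psi fps_X_deriv_nth ..
    have "((fps_X * fps_deriv psi) * A) $ n = (\<Sum>i=0..n. psi $ i * (of_nat i * A $ (n - i)))"
      unfolding fps_mult_nth[of _ A] fps_X_deriv_nth by (simp add: mult_ac)
    then have 2: "(6 * (fps_X * fps_deriv psi) * A) $ n = 6 * (\<Sum>k | tri k \<le> n. of_nat (tri k) * A $ (n - tri k))"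
      unfolding sum_psi by (simp add: mult.assoc fps_numeral_mult_nth)
    have "(psi * (fps_X * fps_deriv A)) $ n - (6 * (fps_X * fps_deriv psi) * A) $ n =
      of_int (\<Sum>k | tri k \<le> n. (int (n - tri k) - 6 * int (tri k)) * divisor_sum_chi4 (4 * (n - tri k) + 3))"
      unfolding 1 2 by (simp add: A_def sum_distrib_left sum_subtractf[symmetric] algebra_simps)
    then show "(psi * (fps_X * fps_deriv A)) $ n = (6 * (fps_X * fps_deriv psi) * A) $ n"
      unfolding divisor_sum_chi4_recurrence by simp
  qed
  have psi6: "psi * (fps_X * fps_deriv (psi ^ 6)) = 6 * (fps_X * fps_deriv psi) * psi ^ 6"
    by (simp add: fps_deriv_power' eval_nat_numeral algebra_simps)
  have "psi * (fps_X * fps_deriv B) =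
      psi * (fps_X * fps_deriv A) - 8 * (psi * (fps_X * fps_deriv (psi ^ 6)))"
    by (simp add: B_def algebra_simps)
  also have "\<dots> = (fps_X * fps_deriv psi) * (6 * B)"
    unfolding A psi6 by (simp add: B_def algebra_simps)
  finally have B: "psi * (fps_X * fps_deriv B) = (fps_X * fps_deriv psi) * (6 * B)" .
  have "tri 0 = 0" by (simp add: tri_def)
  then have "0 \<in> range tri" by (metis rangeI)
  then have psi0: "psi $ 0 = 1" by (simp add: psi_def)
  \<comment> \<open>At \<open>n = 0\<close> the divisors 1 and 3 of 3 give
    \<open>- 1 + 9 = 8\<close>. For \<open>n > 0\<close> the left side reduces to
    \<open>n * B $ n\<close> by induction; on the right the factor \<open>i\<close> kills the term
    containing \<open>B $ n\<close>.\<close>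
  have "B $ n = 0" for n
  proof (induction n rule: less_induct)
    case (less n)
    show ?case
    proof (cases "n = 0")
      case True
      have "{d. d dvd (3::nat)} = {1, 3}"
        using prime_nat_iff[of 3] by auto
      then have "divisor_sum_chi4 3 = 8"
        by (simp add: divisor_sum_chi4_def chi4_def)
      then show ?thesis
        by (simp add: True B_def A_def psi0 fps_power_zeroth fps_numeral_mult_nth)
    next
      case False
      have "(psi * (fps_X * fps_deriv B)) $ n = (\<Sum>i=0..n. psi $ i * (of_nat (n - i) * B $ (n - i)))"
        unfolding fps_mult_nth[of psi] fps_X_deriv_nth ..
      also have "\<dots> = (\<Sum>i\<in>{0}. psi $ i * (of_nat (n - i) * B $ (n - i)))"
        by (rule sum.mono_neutral_right) (auto intro: less)
      finally have "of_nat n * B $ n = ((fps_X * fps_deriv psi) * (6 * B)) $ n"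
        by (simp add: B psi0)
      also have "\<dots> = (\<Sum>i=0..n. of_nat i * psi $ i * (6 * B $ (n - i)))"
        unfolding fps_mult_nth[of _ "6 * B"] fps_X_deriv_nth by (simp add: fps_numeral_mult_nth)
      also have "\<dots> = 0"
      proof (rule sum.neutral, rule ballI)
        fix i assume "i \<in> {0..n}"
        then show "of_nat i * psi $ i * (6 * B $ (n - i)) = 0"
          using less[of "n - i"] False by (cases "i = 0") auto
      qed
      finally show ?thesis using False by simp
    qed
  qed
  from this[of n] show ?thesis
    by (simp add: B_def A_def fps_numeral_mult_nth)
qed

section \<open>\<open>t6\<close> as a coefficient of \<open>psi ^ 6\<close>\<close>

lemma fps_power_nth_cong:
  fixes f g :: "'a :: comm_ring_1 fps"
  assumes "\<And>i. i \<le> n \<Longrightarrow> f $ i = g $ i" "i \<le> n"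
  shows "f ^ k $ i = g ^ k $ i"
  using assms(2)
proof (induction k arbitrary: i)
  case (Suc k)
  then show ?case
    by (auto simp: fps_mult_nth assms(1) intro!: sum.cong)
qed simp

text \<open>Up to degree \<open>m\<close>, \<open>psi\<close> agrees with the polynomial summing
  \<open>fps_X ^ tri k\<close> over \<open>k\<close> up to \<open>m\<close>, because
  \<open>tri k\<close> is at least \<open>k\<close>. Its sixth power expands over functions from
  \<open>{1..6}\<close> to \<open>{..m}\<close>, and each representation of \<open>m\<close>
  contributes 1.\<close>

lemma t6_eq_psi: "of_nat (t6 m) = psi ^ 6 $ m"
proof -
  let ?F = "{1..6::nat} \<rightarrow>\<^sub>E {..m}"
  have tri_ge: "k \<le> tri k" for k
    using strict_mono_imp_increasing[OF strict_mono_tri] .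
  have trunc: "psi $ i = (\<Sum>k\<le>m. fps_X ^ tri k) $ i" if "i \<le> m" for i
  proof -
    have "(\<Sum>k\<le>m. fps_X ^ tri k :: rat fps) $ i = (\<Sum>k\<le>m. if tri k = i then 1 else 0)"
      by (simp add: fps_sum_nth fps_X_power_nth eq_commute)
    also have "\<dots> = (if i \<in> range tri then 1 else 0)"
    proof (cases "i \<in> range tri")
      case True
      then obtain j where j: "i = tri j" by auto
      then have "tri k = i \<longleftrightarrow> k = j" for k
        using strict_mono_eq[OF strict_mono_tri] by simp
      then show ?thesis
        using True j that tri_ge[of j] by simp
    next
      case False
      then have "(\<Sum>k\<le>m. if tri k = i then 1 else 0 :: rat) = 0"
        by (intro sum.neutral) auto
      then show ?thesis using False by simp
    qed
    finally show ?thesis by (simp add: psi_def)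
  qed
  have reps: "t6_reps m = {x \<in> ?F. m = (\<Sum>i=1..6. tri (x i))}"
  proof -
    have "x i \<le> m" if "m = (\<Sum>i=1..6. tri (x i))" "i \<in> {1..6}" for x :: "nat \<Rightarrow> nat" and i
    proof -
      have "tri (x i) \<le> (\<Sum>i=1..6. tri (x i))"
        using that by (intro member_le_sum) auto
      then show ?thesis
        using that tri_ge[of "x i"] by simp
    qed
    then show ?thesis
      unfolding t6_reps_def tri_def[symmetric] by (auto simp: PiE_iff)
  qed
  have "psi ^ 6 $ m = (\<Sum>k\<le>m. fps_X ^ tri k) ^ 6 $ m"
    by (rule fps_power_nth_cong[OF trunc]) auto
  also have "(\<Sum>k\<le>m. fps_X ^ tri k) ^ 6 = (\<Prod>i\<in>{1..6::nat}. \<Sum>k\<le>m. fps_X ^ tri k :: rat fps)"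
    by simp
  also have "\<dots> = (\<Sum>x\<in>?F. \<Prod>i\<in>{1..6}. fps_X ^ tri (x i))"
    by (rule prod_sum_PiE) auto
  also have "\<dots> $ m = (\<Sum>x\<in>?F. if m = (\<Sum>i=1..6. tri (x i)) then 1 else 0)"
    by (simp add: fps_sum_nth fps_X_power_nth flip: power_sum)
  also have "\<dots> = (\<Sum>x\<in>{x \<in> ?F. m = (\<Sum>i=1..6. tri (x i))}. 1)"
    by (rule sum.inter_filter[symmetric]) (auto intro!: finite_PiE)
  also have "\<dots> = of_nat (t6 m)"
    by (simp add: t6_def reps)
  finally show ?thesis ..
qed

section \<open>Return to sigma and the final evaluation\<close>

text \<open>Reversing the sign of an even divisor \<open>2 d\<close> costs \<open>4 d\<close>, and
  these \<open>d\<close> are the divisors of \<open>m / 2\<close>. For odd \<open>m\<close> nothing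
  is reversed and \<open>sigma_rat\<close> is 0 at \<open>m / 2\<close>.\<close>

lemma altsigma_eq_sigma_rat:
  assumes "0 < m"
  shows "of_int (altsigma m) =
    of_nat (sigma_rat (of_nat m)) - (4 :: rat) * of_nat (sigma_rat (of_nat m / 2))"
proof -
  have fin: "finite {d. d dvd m}" using assms by simp
  have "altsigma m = (\<Sum>d | d dvd m. int d - (if even d then 2 * int d else 0))"
    unfolding altsigma_def by (rule sum.cong) auto
  also have "\<dots> = (\<Sum>d | d dvd m. int d) - (\<Sum>d\<in>{d \<in> {d. d dvd m}. even d}. 2 * int d)"
    using sum.inter_filter[OF fin, of "\<lambda>d. 2 * int d" even] by (simp add: sum_subtractf)
  also have "(\<Sum>d\<in>{d \<in> {d. d dvd m}. even d}. 2 * int d) = 4 * int (sigma_rat (of_nat m / 2))"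
  proof (cases "even m")
    case True
    then obtain l where l: "m = 2 * l" by (elim evenE)
    have "(\<Sum>d\<in>{d \<in> {d. d dvd m}. even d}. 2 * int d) = (\<Sum>d | d dvd l. 4 * int d)"
      by (rule sum.reindex_bij_witness[of _ "\<lambda>d. 2 * d" "\<lambda>d. d div 2"]) (auto simp: l)
    moreover have "of_nat m / 2 = (of_nat l :: rat)" by (simp add: l)
    ultimately show ?thesis
      using assms l by (simp add: sigma_rat_of_nat sum_distrib_left)
  next
    case False
    have "of_nat m / 2 \<notin> (\<nat> :: rat set)"
    proof
      assume "of_nat m / 2 \<in> (\<nat> :: rat set)"
      then obtain l where "of_nat m / 2 = (of_nat l :: rat)" by (elim Nats_cases)
      then have "(of_nat m :: rat) = of_nat (2 * l)" by (simp add: field_simps)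
      then have "m = 2 * l" by (simp only: of_nat_eq_iff)
      with False show False by simp
    qed
    then have "sigma_rat (of_nat m / 2) = 0"
      using assms by (simp add: sigma_rat_def)
    moreover have "(\<Sum>d\<in>{d \<in> {d. d dvd m}. even d}. 2 * int d) = 0"
      using False by (intro sum.neutral) (auto dest: dvd_trans)
    ultimately show ?thesis by simp
  qed
  finally have "altsigma m = int (sigma_rat (of_nat m)) - 4 * int (sigma_rat (of_nat m / 2))"
    using assms by (simp add: sigma_rat_of_nat)
  then show ?thesis by simp
qed

theorem theorem4p3:
  fixes n :: nat
  assumes "prime (4 * n + 3)"
  shows "(\<Sum>j<n. (of_nat (t6 j) :: rat) *
            (of_nat (sigma_rat (of_nat (n - j))) - 4 * of_nat (sigma_rat (of_nat (n - j) / 2))))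
         = of_nat n * (of_nat n + 1) * (2 * of_nat n + 1) / 6"
proof -
  let ?S = "Abs_fps (\<lambda>m. of_int (altsigma m)) :: rat fps"
  have "(\<Sum>j<n. (of_nat (t6 j) :: rat) *
            (of_nat (sigma_rat (of_nat (n - j))) - 4 * of_nat (sigma_rat (of_nat (n - j) / 2))))
    = (\<Sum>j<n. psi ^ 6 $ j * ?S $ (n - j))"
    by (intro sum.cong refl) (simp add: t6_eq_psi altsigma_eq_sigma_rat)
  \<comment> \<open>The full convolution has the extra term \<open>j = n\<close>, which vanishes as
    \<open>altsigma 0 = 0\<close>.\<close>
  also have "\<dots> = (psi ^ 6 * ?S) $ n"
    by (simp add: fps_mult_nth atLeast0AtMost lessThan_Suc_atMost[symmetric] altsigma_def)
  \<comment> \<open>The factor 6 completes \<open>6 psi^5 * q psi'\<close>, the Euler derivative of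
    \<open>psi ^ 6\<close>.\<close>
  also have "6 * \<dots> = (6 * (psi ^ 5 * (psi * ?S))) $ n"
    by (simp add: fps_numeral_mult_nth eval_nat_numeral mult.assoc)
  also have "6 * (psi ^ 5 * (psi * ?S)) = fps_X * fps_deriv (psi ^ 6)"
    unfolding X_deriv_psi[symmetric] by (simp add: fps_deriv_power' algebra_simps)
  also have "\<dots> $ n = of_nat n * of_int (divisor_sum_chi4 (4 * n + 3)) / 8"
    by (simp add: fps_X_deriv_nth divisor_sum_chi4_eq_psi)
  \<comment> \<open>Primality leaves only the divisors 1 and \<open>4 n + 3\<close>, with
    \<open>chi4\<close> equal to 1 and -1.\<close>
  also have "divisor_sum_chi4 (4 * n + 3) = int (4 * n + 3) ^ 2 - 1"
  proof -
    have "{d. d dvd 4 * n + 3} = {1, 4 * n + 3}"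
      using assms by (auto simp: prime_nat_iff)
    moreover have "chi4 (int (4 * n + 3)) = - 1" "chi4 1 = 1"
      unfolding chi4_def by (simp_all, presburger?)
    ultimately show ?thesis
      by (simp add: divisor_sum_chi4_def)
  qed
  finally show ?thesis
    by (simp add: power2_eq_square field_simps)
qed

end
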